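(* Let $(S,\bullet)$ be a partial semigroup and assume there is a minimal left ideal $L$ of $S$ which contains an idempotent $e$. Then $e\bullet L$ is a partial group.
   Context: A partial semigroup is a nonempty set $S$ with a partially defined operation $\bullet$ such that $(x\bullet y)\bullet z=x\bullet(y\bullet z)$ in the sense that if either side is defined so is the other and they are equal. $L(x)=\{s:s\bullet x\text{ defined}\}$. A left ideal is a nonempty $I\subseteq S$ with $y\bullet x\in I$ whenever $x\in I$ and $y\in L(x)$; minimal if it contains no other left ideal. $e$ is idempotent if $e\bullet e=e$. $e\bullet L=\{e\bullet x:x\in L,\ e\bullet x\text{ defined}\}$, with the restricted operation. A partial semigroup $G$ is a partial group if there is an idempotent $e\in G$ with $e\bullet s$ defined and equal to $s$ for all $s\in G$, and for every $x\in G$ there is $y\in G$ with $y\bullet x$ defined and equal to $e$. *)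

theory Defs
  imports Main
begin

text \<open>
  A partial operation on the carrier \<^term>\<open>S\<close> is a function
  \<^typ>\<open>'a \<Rightarrow> 'a \<Rightarrow> 'a option\<close>, with \<^const>\<open>None\<close> for an undefined product.
  All notions below look at the operation only on the given carrier, so a subset of \<^term>\<open>S\<close>
  with the restricted operation is that subset together with the same function; that the
  subset is closed under the operation is then part of it being a partial semigroup.
\<close>

text \<open>
  Both sides of the associativity law are \<^const>\<open>None\<close> as soon as one of their two products is
  undefined, so the equation says that either both sides are undefined or both are
  defined and equal.
\<close>

locale partial_semigroup =
  fixes S :: "'a set" and m :: "'a \<Rightarrow> 'a \<Rightarrow> 'a option"
  assumes nonempty: "S \<noteq> {}"
    and closed: "\<lbrakk>x \<in> S; y \<in> S; m x y = Some z\<rbrakk> \<Longrightarrow> z \<in> S"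
    and assoc: "\<lbrakk>x \<in> S; y \<in> S; z \<in> S\<rbrakk> \<Longrightarrow>
      Option.bind (m x y) (\<lambda>u. m u z) = Option.bind (m y z) (\<lambda>v. m x v)"

definition left_domain :: "'a set \<Rightarrow> ('a \<Rightarrow> 'a \<Rightarrow> 'a option) \<Rightarrow> 'a \<Rightarrow> 'a set" where
  "left_domain S m x = {s \<in> S. m s x \<noteq> None}"

definition left_ideal :: "'a set \<Rightarrow> ('a \<Rightarrow> 'a \<Rightarrow> 'a option) \<Rightarrow> 'a set \<Rightarrow> bool" where
  "left_ideal S m I \<longleftrightarrow>
     I \<noteq> {} \<and> I \<subseteq> S \<and> (\<forall>x\<in>I. \<forall>y\<in>left_domain S m x. the (m y x) \<in> I)"

definition minimal_left_ideal :: "'a set \<Rightarrow> ('a \<Rightarrow> 'a \<Rightarrow> 'a option) \<Rightarrow> 'a set \<Rightarrow> bool" where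
  "minimal_left_ideal S m L \<longleftrightarrow>
     left_ideal S m L \<and> (\<forall>I. left_ideal S m I \<and> I \<subseteq> L \<longrightarrow> I = L)"

definition idempotent_elem :: "('a \<Rightarrow> 'a \<Rightarrow> 'a option) \<Rightarrow> 'a \<Rightarrow> bool" where
  "idempotent_elem m e \<longleftrightarrow> m e e = Some e"

definition left_translate :: "('a \<Rightarrow> 'a \<Rightarrow> 'a option) \<Rightarrow> 'a \<Rightarrow> 'a set \<Rightarrow> 'a set" where
  "left_translate m e L = {z. \<exists>x\<in>L. m e x = Some z}"

definition partial_group :: "'a set \<Rightarrow> ('a \<Rightarrow> 'a \<Rightarrow> 'a option) \<Rightarrow> bool" where
  "partial_group G m \<longleftrightarrow> partial_semigroup G m \<and>
     (\<exists>e\<in>G. idempotent_elem m e \<and> (\<forall>s\<in>G. m e s = Some s) \<and>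
        (\<forall>x\<in>G. \<exists>y\<in>G. m y x = Some e))"

end

theory Submission
  imports Defs
begin

text \<open>
  For an idempotent \<open>e\<close> of the left ideal \<open>L\<close>, the set \<open>e \<bullet> L\<close> consists of the elements of \<open>L\<close>
  fixed by left multiplication by \<open>e\<close>. For \<open>x\<close> in it, \<open>L \<bullet> x\<close> is a left ideal contained in \<open>L\<close>,
  nonempty because it contains \<open>e \<bullet> x\<close>. By minimality it contains \<open>e\<close>, so \<open>l \<bullet> x = e\<close> for some
  \<open>l \<in> L\<close>, and \<open>e \<bullet> l\<close> is a left inverse of \<open>x\<close> in \<open>e \<bullet> L\<close>.
\<close>

lemma left_idealD:
  assumes "left_ideal S m I" and "x \<in> I" and "y \<in> S" and "m y x = Some z"
  shows "z \<in> I"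
proof -
  have "y \<in> left_domain S m x"
    using assms(3,4) by (simp add: left_domain_def)
  then have "the (m y x) \<in> I"
    using assms(1,2) by (simp add: left_ideal_def)
  then show ?thesis
    using assms(4) by simp
qed

lemma left_ideal_subset: "left_ideal S m I \<Longrightarrow> I \<subseteq> S"
  by (simp add: left_ideal_def)

context partial_semigroup
begin

text \<open>This and its converse \<open>assoc_right\<close> turn the \<open>Option.bind\<close> law
  into a transfer of definedness: once one bracketing is defined, both products of the other exist
  and give the same value.\<close>

lemma assoc_left:
  assumes "x \<in> S" "y \<in> S" "z \<in> S" and "m x y = Some u" and "m u z = Some w"
  shows "\<exists>v. m y z = Some v \<and> m x v = Some w"
  using assoc[OF assms(1-3)] assms(4,5) by (cases "m y z") auto

lemma assoc_right:
  assumes "x \<in> S" "y \<in> S" "z \<in> S" and "m y z = Some v" and "m x v = Some w"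
  shows "\<exists>u. m x y = Some u \<and> m u z = Some w"
  using assoc[OF assms(1-3)] assms(4,5) by (cases "m x y") auto

text \<open>If \<open>z\<close> is e \<bullet> x, then reading z as (e \<bullet> e) \<bullet> x and
  reassociating shows that e \<bullet> z is defined and equals z.\<close>

lemma left_translate_idempotent:
  assumes L: "left_ideal S m L" and "e \<in> L" and "idempotent_elem m e"
  shows "left_translate m e L = {z \<in> L. m e z = Some z}"
proof -
  have ee: "m e e = Some e"
    using assms(3) by (simp add: idempotent_elem_def)
  have LS: "L \<subseteq> S"
    using L by (rule left_ideal_subset)
  have "z \<in> L \<and> m e z = Some z" if x: "x \<in> L" and ex: "m e x = Some z" for x z
  proof
    show "z \<in> L"
      using left_idealD[OF L x _ ex] LS \<open>e \<in> L\<close> by blast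
    obtain v where "m e x = Some v" "m e v = Some z"
      using assoc_left[of e e x e z] ee ex x LS \<open>e \<in> L\<close> by blast
    then show "m e z = Some z"
      using ex by simp
  qed
  then show ?thesis
    unfolding left_translate_def by blast
qed

text \<open>Any defined t \<bullet> (k \<bullet> x) equals (t \<bullet> k) \<bullet> x, and t
  \<bullet> k stays in \<open>L\<close>. The given \<open>l\<close> ensures nonemptiness.\<close>

lemma left_ideal_right_translate:
  assumes L: "left_ideal S m L" and x: "x \<in> S" and "l \<in> L" and "m l x \<noteq> None"
  shows "left_ideal S m {z. \<exists>l\<in>L. m l x = Some z}"
  unfolding left_ideal_def
proof (intro conjI ballI)
  have LS: "L \<subseteq> S"
    using L by (rule left_ideal_subset)
  show "{z. \<exists>l\<in>L. m l x = Some z} \<noteq> {}"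
    using assms by auto
  show "{z. \<exists>l\<in>L. m l x = Some z} \<subseteq> S"
    using LS closed[OF _ x] by auto
  fix z t assume "z \<in> {z. \<exists>l\<in>L. m l x = Some z}" and "t \<in> left_domain S m z"
  then obtain k w where k: "k \<in> L" "m k x = Some z" and t: "t \<in> S" "m t z = Some w"
    by (auto simp: left_domain_def)
  then obtain u where u: "m t k = Some u" "m u x = Some w"
    using assoc_right[of t k x z w] LS x by blast
  have "u \<in> L"
    using left_idealD[OF L k(1) t(1) u(1)] .
  then show "the (m t z) \<in> {z. \<exists>l\<in>L. m l x = Some z}"
    using u t by auto
qed

text \<open>With \<open>x\<close> in \<open>L\<close>, the left ideal L \<bullet> x lies inside
  \<open>L\<close>, so minimality forces equality.\<close>

lemma minimal_left_ideal_right_translate: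
  assumes L: "minimal_left_ideal S m L" and x: "x \<in> L" and "l \<in> L" and "m l x \<noteq> None"
  shows "{z. \<exists>l\<in>L. m l x = Some z} = L"
proof -
  have I: "left_ideal S m L"
    using L by (simp add: minimal_left_ideal_def)
  have LS: "L \<subseteq> S"
    using I by (rule left_ideal_subset)
  have "{z. \<exists>l\<in>L. m l x = Some z} \<subseteq> L"
    using left_idealD[OF I x] LS by blast
  moreover have "left_ideal S m {z. \<exists>l\<in>L. m l x = Some z}"
    using left_ideal_right_translate[OF I] x LS assms(3,4) by blast
  ultimately show ?thesis
    using L by (simp add: minimal_left_ideal_def)
qed

end

theorem theorem2p12:
  fixes S :: "'a set" and m :: "'a \<Rightarrow> 'a \<Rightarrow> 'a option" and L :: "'a set" and e :: 'a
  assumes "partial_semigroup S m"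
    and "minimal_left_ideal S m L"
    and "e \<in> L"
    and "idempotent_elem m e"
  shows "partial_group (left_translate m e L) m"
proof -
  interpret partial_semigroup S m by fact
  have L: "left_ideal S m L"
    using assms(2) by (simp add: minimal_left_ideal_def)
  have LS: "L \<subseteq> S"
    using L by (rule left_ideal_subset)
  have ee: "m e e = Some e"
    using assms(4) by (simp add: idempotent_elem_def)
  define G where "G = left_translate m e L"
  have G: "G = {z \<in> L. m e z = Some z}"
    unfolding G_def using left_translate_idempotent[OF L assms(3,4)] .
  have eG: "e \<in> G"
    using G ee assms(3) by simp
  have semigroup: "partial_semigroup G m"
  proof
    show "G \<noteq> {}"
      using eG by blast
  next
    fix x y z assume xy: "x \<in> G" "y \<in> G" "m x y = Some z"
    then have x: "x \<in> S" "m e x = Some x" and y: "y \<in> L" "y \<in> S"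
      using G LS by auto
    have "z \<in> L"
      using left_idealD[OF L y(1) x(1) xy(3)] .
    \<comment> \<open>Reassociate (e \<bullet> x) \<bullet> y, which is x \<bullet> y because
      \<open>e\<close> fixes \<open>x\<close>.\<close>
    moreover obtain v where "m x y = Some v" "m e v = Some z"
      using assoc_left[of e x y x z] x y xy(3) LS assms(3) by blast
    then have "m e z = Some z"
      using xy(3) by simp
    ultimately show "z \<in> G"
      by (simp add: G)
  next
    fix x y z assume "x \<in> G" "y \<in> G" "z \<in> G"
    then show "Option.bind (m x y) (\<lambda>u. m u z) = Option.bind (m y z) (\<lambda>v. m x v)"
      using G LS by (intro assoc) auto
  qed
  have inverse: "\<exists>y\<in>G. m y x = Some e" if "x \<in> G" for x
  proof -
    have x: "x \<in> L" "m e x = Some x"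
      using that G by auto
    then have "{z. \<exists>l\<in>L. m l x = Some z} = L"
      using minimal_left_ideal_right_translate[OF assms(2) x(1) assms(3)] by simp
    then obtain l where l: "l \<in> L" "m l x = Some e"
      using assms(3) by blast
    \<comment> \<open>Here \<open>y\<close> is e \<bullet> l: the product e \<bullet> (l \<bullet>
      x) is e \<bullet> e, hence defined and equal to e, so associativity also makes e \<bullet> l
      defined.\<close>
    then obtain y where y: "m e l = Some y" "m y x = Some e"
      using assoc_right[of e l x e e] x ee LS assms(3) by blast
    then have "y \<in> G"
      using l by (auto simp: G_def left_translate_def)
    then show ?thesis
      using y by blast
  qed
  have "\<forall>s\<in>G. m e s = Some s"
    using G by simp
  with semigroup eG assms(4) inverse show ?thesis
    unfolding partial_group_def G_def[symmetric] by blast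
qed

end
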